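(* Let $n\ge2$. For $a\ge0$ set $$b(a)=\operatorname{arsinh}\!\Big[\tfrac1{\sqrt2}\sinh(2a)\Big],\qquad r_j(a)=a+(n-j)b(a)\ (1\le j\le n),\qquad N(a)=\sum_{j=1}^n\sinh^2 r_j(a).$$ Then $b(a)$, every $r_j(a)$, and $N(a)$ are strictly increasing in $a\ge0$, and $b(a)>a$ for every $a>0$. As $a\to0$, $$b(a)=\sqrt2\,a+\mathcal O(a^3),\qquad \frac{r_j(a)}a=1+\sqrt2\,(n-j)+\mathcal O(a^2).$$ As $a\to\infty$, $$b(a)=2a-\tfrac12\ln2+\mathcal O(e^{-4a}),\qquad r_j(a)=(2n-2j+1)a-\tfrac{n-j}2\ln2+\mathcal O(e^{-4a}),$$ and consequently $r_j(a)/a\to 2n-2j+1$ for every $j=1,\dots,n$.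
   Context: The family $\bm r(a)$ is the one-parameter family of spectra that maximize, at fixed mean photon number $N=\sum_j\sinh^2r_j$ and among $r_1\ge\cdots\ge r_n\ge0$, the smallest of the numbers $2\sinh^2(2r_j)$, $4\sinh^2(r_j-r_k)$, $4\sinh^2(r_j+r_k)$ ($j<k$); the relation defining $b(a)$ is the balance condition $2\sinh^2(2a)=4\sinh^2 b$. The direction $(2n-1,2n-3,\dots,3,1)$ is the dual-Weyl direction of the $C_n$ root system. *)

theory Defs
  imports Complex_Main "HOL-Library.Landau_Symbols"
begin

definition spec_b :: "real \<Rightarrow> real" where
  "spec_b a = arsinh (1 / sqrt 2 * sinh (2 * a))"

definition spec_r :: "nat \<Rightarrow> nat \<Rightarrow> real \<Rightarrow> real" where
  "spec_r n j a = a + (real n - real j) * spec_b a"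

definition mean_photon :: "nat \<Rightarrow> real \<Rightarrow> real" where
  "mean_photon n a = (\<Sum>j = 1..n. (sinh (spec_r n j a))\<^sup>2)"

end

(* Everything rests on the relation sinh (b a) = sinh (2 a) / sqrt 2.  Since sinh is increasing,
   comparing sinh at explicit points gives b a > a, and also the two-sided bound
   0 <= b a - (2 a - ln 2 / 2) <= exp (- 4 a), valid for every real a, which yields the
   asymptotics at infinity.  Near 0, arsinh s - s and sinh (2 a) - 2 a are both cubic. *)
theory Submission
  imports Defs "HOL-Real_Asymp.Real_Asymp"
begin

lemma strict_mono_spec_b: "strict_mono spec_b"
  by (intro strict_monoI) (simp add: spec_b_def divide_strict_right_mono)

lemma sinh_spec_b: "sinh (spec_b a) = 1 / sqrt 2 * sinh (2 * a)"
  by (simp add: spec_b_def)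

lemma spec_b_0: "spec_b 0 = 0"
  by (simp add: spec_b_def)

lemma spec_b_nonneg: "0 \<le> a \<Longrightarrow> 0 \<le> spec_b a"
  using strict_mono_less_eq[OF strict_mono_spec_b, of 0 a] by (simp add: spec_b_0)

lemma strict_mono_spec_r:
  assumes "j \<le> n"
  shows "strict_mono (spec_r n j)"
proof (rule strict_monoI)
  fix x y :: real
  assume "x < y"
  \<comment> \<open>The weight \<open>real n - real j\<close> vanishes at \<open>j = n\<close>, so
    this comparison is only weak; strictness comes from the summand \<open>a\<close> in
    \<open>spec_r\<close>.\<close>
  then have "(real n - real j) * spec_b x \<le> (real n - real j) * spec_b y"
    using assms strict_monoD[OF strict_mono_spec_b, of x y] by (simp add: mult_left_mono)
  with \<open>x < y\<close> show "spec_r n j x < spec_r n j y"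
    by (simp add: spec_r_def)
qed

lemma spec_r_nonneg: "j \<le> n \<Longrightarrow> 0 \<le> a \<Longrightarrow> 0 \<le> spec_r n j a"
  by (simp add: spec_r_def spec_b_nonneg)

lemma strict_mono_on_mean_photon:
  assumes "n \<ge> 1"
  shows "strict_mono_on {0..} (mean_photon n)"
proof (rule strict_mono_onI)
  fix x y :: real
  assume "x \<in> {0..}" "y \<in> {0..}" "x < y"
  show "mean_photon n x < mean_photon n y"
    unfolding mean_photon_def
  proof (rule sum_strict_mono)
    fix j assume "j \<in> {1..n}"
    then have "spec_r n j x < spec_r n j y" and "0 \<le> spec_r n j x"
      using \<open>x < y\<close> \<open>x \<in> {0..}\<close> strict_monoD[OF strict_mono_spec_r] spec_r_nonneg by auto
    \<comment> \<open>Squaring keeps the order because \<open>sinh\<close> is nonnegative at the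
      smaller point, which is where \<open>x\<close> in \<open>{0..}\<close> enters.\<close>
    then show "(sinh (spec_r n j x))\<^sup>2 < (sinh (spec_r n j y))\<^sup>2"
      by (intro power_strict_mono) auto
  qed (use assms in auto)
qed

text \<open>By the double-angle formula, \<open>1 / sqrt 2 * sinh (2 * a)\<close> is
  \<open>sinh a\<close> times \<open>sqrt 2 * cosh a\<close>, a factor above 1.\<close>

lemma spec_b_gt_self:
  assumes "a > 0"
  shows "spec_b a > a"
proof -
  have "1 < sqrt 2 * cosh a"
    using cosh_real_ge_1[of a] less_le_trans[of 1 "sqrt 2" "sqrt 2 * cosh a"] by simp
  then have "sinh a < sqrt 2 * cosh a * sinh a"
    using assms by simp
  also have "\<dots> = 1 / sqrt 2 * sinh (2 * a)"
    unfolding sinh_double by (simp add: field_simps)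
  finally have "sinh a < sinh (spec_b a)"
    unfolding sinh_spec_b .
  then show ?thesis by simp
qed

text \<open>\<open>arsinh\<close> is odd with slope 1 at 0, so its expansion has no quadratic
  term.\<close>

lemma arsinh_minus_id_at_0: "(\<lambda>s::real. arsinh s - s) \<in> O[at_right 0](\<lambda>s. s ^ 3)"
  unfolding arsinh_real_def by real_asymp

lemma spec_b_at_0: "(\<lambda>a. spec_b a - sqrt 2 * a) \<in> O[at_right 0](\<lambda>a. a ^ 3)"
proof -
  define s where "s = (\<lambda>a::real. 1 / sqrt 2 * sinh (2 * a))"
  \<comment> \<open>Substituting \<open>s\<close> into a one-sided estimate requires that
    \<open>s a\<close> tend to 0 through positive values.\<close>
  have "filterlim s (at_right 0) (at_right 0)"
    unfolding s_def sinh_field_def by real_asymp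
  then have "(\<lambda>a. arsinh (s a) - s a) \<in> O[at_right 0](\<lambda>a. s a ^ 3)"
    by (rule landau_o.big.compose[OF arsinh_minus_id_at_0])
  also have "s \<in> O[at_right 0](\<lambda>a. a)"
    unfolding s_def sinh_field_def by real_asymp
  then have "(\<lambda>a. s a ^ 3) \<in> O[at_right 0](\<lambda>a. a ^ 3)"
    by (rule landau_o.big_power)
  finally have arsinh_part: "(\<lambda>a. arsinh (s a) - s a) \<in> O[at_right 0](\<lambda>a. a ^ 3)" .
  have "(\<lambda>a::real. sinh (2 * a) - 2 * a) \<in> O[at_right 0](\<lambda>a. a ^ 3)"
    unfolding sinh_field_def by real_asymp
  then have "(\<lambda>a. 1 / sqrt 2 * (sinh (2 * a) - 2 * a)) \<in> O[at_right 0](\<lambda>a. a ^ 3)"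
    by simp
  also have "(\<lambda>a. 1 / sqrt 2 * (sinh (2 * a) - 2 * a)) = (\<lambda>a. s a - sqrt 2 * a)"
    by (simp add: s_def field_simps fun_eq_iff)
  finally have "(\<lambda>a. (arsinh (s a) - s a) + (s a - sqrt 2 * a)) \<in> O[at_right 0](\<lambda>a. a ^ 3)"
    by (rule sum_in_bigo(1)[OF arsinh_part])
  then show ?thesis
    by (simp add: s_def spec_b_def)
qed

lemma exp_asymptote: "exp (2 * a - ln 2 / 2) = exp (2 * a) / sqrt (2::real)"
  by (simp add: exp_diff flip: ln_sqrt)

text \<open>Over the common denominator \<open>2 * sqrt 2\<close>, the two values of
  \<open>sinh\<close> share the term \<open>exp (2 * a)\<close> and differ only in the coefficient
  of \<open>exp (- (2 * a))\<close>: -2 against -1.\<close>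

lemma spec_b_ge: "2 * a - ln 2 / 2 \<le> spec_b a"
proof -
  have "sinh (2 * a - ln 2 / 2) = (exp (2 * a) - 2 * exp (- (2 * a))) / (2 * sqrt 2)"
    unfolding sinh_field_def exp_minus[of "2 * a - ln 2 / 2"] exp_asymptote
    by (simp add: exp_minus field_simps)
  also have "\<dots> \<le> 1 / sqrt 2 * sinh (2 * a)"
    by (simp add: sinh_field_def field_simps)
  finally have "sinh (2 * a - ln 2 / 2) \<le> sinh (spec_b a)"
    unfolding sinh_spec_b .
  then show ?thesis by simp
qed

lemma spec_b_le: "spec_b a \<le> 2 * a - ln 2 / 2 + exp (- 4 * a)"
proof -
  let ?u = "exp (- 4 * a)"
  \<comment> \<open>Since \<open>exp (2 * a) * ?u = exp (- (2 * a))\<close>, one copy of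
    \<open>exp (- (2 * a))\<close> is added and subtracted, so that the next step needs only
    \<open>1 + ?u \<le> exp ?u\<close> and \<open>exp (- ?u) \<le> 1\<close>.\<close>
  have "1 / sqrt 2 * sinh (2 * a) = (exp (2 * a) * (1 + ?u) - 2 * exp (- (2 * a))) / (2 * sqrt 2)"
    by (simp add: sinh_field_def distrib_left flip: exp_add)
  also have "\<dots> \<le> (exp (2 * a) * exp ?u - 2 * exp (- (2 * a)) * exp (- ?u)) / (2 * sqrt 2)"
    by (intro divide_right_mono diff_mono mult_left_mono) auto
  also have "\<dots> = sinh (2 * a - ln 2 / 2 + ?u)"
    unfolding sinh_field_def exp_minus[of "2 * a - ln 2 / 2 + ?u"] exp_add[of "2 * a - ln 2 / 2"]
      exp_asymptote
    by (simp add: exp_minus field_simps)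
  finally have "sinh (spec_b a) \<le> sinh (2 * a - ln 2 / 2 + ?u)"
    unfolding sinh_spec_b .
  then show ?thesis by simp
qed

lemma spec_b_at_top: "(\<lambda>a. spec_b a - (2 * a - ln 2 / 2)) \<in> O[at_top](\<lambda>a. exp (- 4 * a))"
proof (rule bigoI[where c = 1], rule always_eventually, rule allI)
  fix a
  show "norm (spec_b a - (2 * a - ln 2 / 2)) \<le> 1 * norm (exp (- 4 * a))"
    using spec_b_ge[of a] spec_b_le[of a] by simp
qed

text \<open>The error is \<open>real n - real j\<close> times that of \<open>spec_b\<close>, divided
  by \<open>a\<close>, which lowers the cubic order to quadratic. The identity needs
  \<open>a \<noteq> 0\<close>, hence the eventual equalities.\<close>

lemma spec_r_at_0:
  "(\<lambda>a. spec_r n j a / a - (1 + sqrt 2 * (real n - real j))) \<in> O[at_right 0](\<lambda>a. a ^ 2)"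
proof -
  have pos: "\<forall>\<^sub>F a::real in at_right 0. 0 < a"
    by (rule eventually_at_right_less)
  have "(\<lambda>a. (real n - real j) * (spec_b a - sqrt 2 * a)) \<in> O[at_right 0](\<lambda>a. a ^ 3)"
    using spec_b_at_0 by simp
  then have "(\<lambda>a. (real n - real j) * (spec_b a - sqrt 2 * a) / a) \<in> O[at_right 0](\<lambda>a. a ^ 3 / a)"
    by (rule landau_o.big.divide_right[rotated]) (use pos in \<open>auto elim: eventually_mono\<close>)
  moreover have "\<forall>\<^sub>F a in at_right 0. (real n - real j) * (spec_b a - sqrt 2 * a) / a
      = spec_r n j a / a - (1 + sqrt 2 * (real n - real j))"
    using pos by eventually_elim (simp add: spec_r_def field_simps)
  moreover have "\<forall>\<^sub>F a::real in at_right 0. a ^ 3 / a = a ^ 2"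
    using pos by eventually_elim (simp add: power3_eq_cube power2_eq_square)
  ultimately show ?thesis
    by (simp add: landau_o.big.cong landau_o.big.in_cong)
qed

text \<open>The error is exactly \<open>real n - real j\<close> times the error of
  \<open>spec_b\<close>.\<close>

lemma spec_r_at_top:
  "(\<lambda>a. spec_r n j a - ((2 * real n - 2 * real j + 1) * a - (real n - real j) / 2 * ln 2))
     \<in> O[at_top](\<lambda>a. exp (- 4 * a))"
proof -
  have "(\<lambda>a. (real n - real j) * (spec_b a - (2 * a - ln 2 / 2))) \<in> O[at_top](\<lambda>a. exp (- 4 * a))"
    using spec_b_at_top by simp
  then show ?thesis
    by (simp add: spec_r_def algebra_simps)
qed

lemma spec_b_over_self_at_top: "((\<lambda>a. spec_b a / a) \<longlongrightarrow> 2) at_top"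
proof (rule tendsto_sandwich)
  show "\<forall>\<^sub>F a in at_top. (2 * a - ln 2 / 2) / a \<le> spec_b a / a"
    using eventually_gt_at_top[of 0]
    by eventually_elim (intro divide_right_mono spec_b_ge less_imp_le)
  show "\<forall>\<^sub>F a in at_top. spec_b a / a \<le> (2 * a - ln 2 / 2 + exp (- 4 * a)) / a"
    using eventually_gt_at_top[of 0]
    by eventually_elim (intro divide_right_mono spec_b_le less_imp_le)
qed real_asymp+

text \<open>For \<open>j\<close> from 1 to \<open>n\<close> these limits form (2n-1, 2n-3, ..., 3,
  1), the dual-Weyl direction of the C_n root system.\<close>

lemma spec_r_over_self_at_top:
  "((\<lambda>a. spec_r n j a / a) \<longlongrightarrow> 2 * real n - 2 * real j + 1) at_top"
proof -
  have "((\<lambda>a. 1 + (real n - real j) * (spec_b a / a)) \<longlongrightarrow> 1 + (real n - real j) * 2) at_top"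
    by (intro tendsto_intros spec_b_over_self_at_top)
  moreover have "\<forall>\<^sub>F a in at_top. 1 + (real n - real j) * (spec_b a / a) = spec_r n j a / a"
    using eventually_gt_at_top[of 0]
    by eventually_elim (simp add: spec_r_def field_simps)
  ultimately show ?thesis
    by (auto simp: algebra_simps dest: Lim_transform_eventually)
qed

theorem mainTheorem7:
  fixes n :: nat
  assumes "n \<ge> 2"
  shows "strict_mono_on {0..} spec_b
    \<and> (\<forall>j\<in>{1..n}. strict_mono_on {0..} (spec_r n j))
    \<and> strict_mono_on {0..} (mean_photon n)
    \<and> (\<forall>a>0. spec_b a > a)
    \<and> (\<lambda>a. spec_b a - sqrt 2 * a) \<in> O[at_right 0](\<lambda>a. a ^ 3)
    \<and> (\<forall>j\<in>{1..n}. (\<lambda>a. spec_r n j a / a - (1 + sqrt 2 * (real n - real j)))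
          \<in> O[at_right 0](\<lambda>a. a ^ 2))
    \<and> (\<lambda>a. spec_b a - (2 * a - ln 2 / 2)) \<in> O[at_top](\<lambda>a. exp (- 4 * a))
    \<and> (\<forall>j\<in>{1..n}. (\<lambda>a. spec_r n j a
            - ((2 * real n - 2 * real j + 1) * a - (real n - real j) / 2 * ln 2))
          \<in> O[at_top](\<lambda>a. exp (- 4 * a)))
    \<and> (\<forall>j\<in>{1..n}. ((\<lambda>a. spec_r n j a / a) \<longlongrightarrow> 2 * real n - 2 * real j + 1) at_top)"
proof (intro conjI ballI allI impI)
  show "strict_mono_on {0..} spec_b"
    using strict_mono_spec_b by (rule monotone_on_subset) simp
  show "strict_mono_on {0..} (spec_r n j)" if "j \<in> {1..n}" for j
    using that by (intro monotone_on_subset[OF strict_mono_spec_r]) simp_all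
qed (use assms in \<open>simp_all only: strict_mono_on_mean_photon spec_b_gt_self spec_b_at_0
  spec_r_at_0 spec_b_at_top spec_r_at_top spec_r_over_self_at_top\<close>)

end
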